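(* Let $m \in \mathbb{N}$ and let $N_1,\dots,N_{m+1}, nv_m, dv_m, snv_m, sdv_m, nv_{m+1}, dv_{m+1}, snv_{m+1}, sdv_{m+1} \in \mathbb{N}$ satisfy $$\begin{bmatrix} nv_m & snv_m\\ dv_m & sdv_m \end{bmatrix} = \begin{bmatrix} 0 & 1\\ 1 & 0 \end{bmatrix} \prod_{k=1}^{m} \begin{bmatrix} 1 & 1\\ N_k & N_k+1 \end{bmatrix}$$ and $$\begin{bmatrix} nv_{m+1} & snv_{m+1}\\ dv_{m+1} & sdv_{m+1} \end{bmatrix} = \begin{bmatrix} 0 & 1\\ 1 & 0 \end{bmatrix} \prod_{k=1}^{m+1} \begin{bmatrix} 1 & 1\\ N_k & N_k+1 \end{bmatrix}.$$ Then $$\frac{nv_m}{dv_m} < \frac{nv_{m+1}}{dv_{m+1}} < \frac{snv_m}{sdv_m}.$$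
   Context: $\mathbb{N}$ denotes the positive integers. The product $\prod_{k=1}^m M_k$ of $2\times 2$ matrices is taken in the order $M_1 M_2 \cdots M_m$. (Interpretation: $nv_m/dv_m$ is the rational key of the tree node at position $[\circ N_1 \circ \cdots \circ N_m]$, $snv_m/sdv_m$ is the rational key of its next sibling, and $nv_{m+1}/dv_{m+1}$ is the rational key of its $N_{m+1}$-th child.) *)

theory Defs
  imports "HOL-Analysis.Analysis"
begin

text \<open>All matrices have entries in \<^typ>\<open>nat\<close> (no subtraction occurs). Positivity of the entries
  is a separate hypothesis wherever the natural numbers are meant to start at 1.\<close>

definition mat22 :: "nat \<Rightarrow> nat \<Rightarrow> nat \<Rightarrow> nat \<Rightarrow> nat ^ 2 ^ 2" where
  "mat22 a b c d = vector [vector [a, b], vector [c, d]]"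

text \<open>The product is ordered from left to right: \<open>ordered_mat_prod M m = M 1 ** M 2 ** \<dots> ** M m\<close>.\<close>

primrec ordered_mat_prod :: "(nat \<Rightarrow> nat ^ 2 ^ 2) \<Rightarrow> nat \<Rightarrow> nat ^ 2 ^ 2" where
  "ordered_mat_prod M 0 = mat 1"
| "ordered_mat_prod M (Suc m) = ordered_mat_prod M m ** M (Suc m)"

end

theory Submission
  imports Defs
begin

text \<open>Appending a factor replaces the left column by the weighted mediant
  $(nv + N\,snv) / (dv + N\,sdv)$ of the two columns. A mediant with positive weights lies strictly
  between the two fractions, and these are in increasing order since the determinant of the product
  is always $-1$.\<close>

lemma mat22_nth [simp]:
  "mat22 a b c d $ 1 $ 1 = a" "mat22 a b c d $ 1 $ 2 = b"
  "mat22 a b c d $ 2 $ 1 = c" "mat22 a b c d $ 2 $ 2 = d"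
  by (simp_all add: mat22_def)

lemma mat22_mult:
  "mat22 a b c d ** mat22 e f g h = mat22 (a*e + b*g) (a*f + b*h) (c*e + d*g) (c*f + d*h)"
  by (simp add: vec_eq_iff forall_2 matrix_matrix_mult_def sum_2)

lemma mat22_eq_iff: "mat22 a b c d = mat22 e f g h \<longleftrightarrow> a = e \<and> b = f \<and> c = g \<and> d = h"
  by (auto dest: arg_cong[where f = "\<lambda>A. (A$1$1, A$1$2, A$2$1, A$2$2)"])

text \<open>Lets an induction over the product name the four entries of a partial product, which is
  not syntactically a \<open>mat22\<close>.\<close>

lemma mat22_surj: "\<exists>a b c d. A = mat22 a b c d"
  by (intro exI[of _ "A$1$1"] exI[of _ "A$1$2"] exI[of _ "A$2$1"] exI[of _ "A$2$2"])
     (simp add: vec_eq_iff forall_2)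

\<comment> \<open>The determinant is $-1$, written without subtraction.\<close>
lemma ordered_mat_prod_det:
  assumes "mat22 a b c d = mat22 0 1 1 0 ** ordered_mat_prod (\<lambda>k. mat22 1 1 (N k) (N k + 1)) m"
  shows "b * c = a * d + 1"
  using assms
proof (induction m arbitrary: a b c d)
  case 0
  then have "mat22 a b c d = mat22 0 1 1 0"
    by (simp only: ordered_mat_prod.simps matrix_mul_rid)
  then show ?case
    by (simp add: mat22_eq_iff)
next
  case (Suc m)
  obtain a' b' c' d' where
    prev: "mat22 0 1 1 0 ** ordered_mat_prod (\<lambda>k. mat22 1 1 (N k) (N k + 1)) m = mat22 a' b' c' d'"
    using mat22_surj by blast
  have "b' * c' = a' * d' + 1"
    by (rule Suc.IH) (rule prev[symmetric])
  \<comment> \<open>Associativity splits off the last factor, whose determinant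
    \<open>(N + 1) - N\<close> is 1, so the value -1 is preserved.\<close>
  moreover have "mat22 a b c d = mat22 a' b' c' d' ** mat22 1 1 (N (Suc m)) (N (Suc m) + 1)"
    using Suc.prems by (simp only: ordered_mat_prod.simps matrix_mul_assoc prev)
  ultimately show ?case
    by (simp add: mat22_mult mat22_eq_iff algebra_simps)
qed

text \<open>After cross-multiplication \<open>a * b\<close> cancels in the first claim and
  \<open>w * c * d\<close> in the second; what remains is \<open>a * d < c * b\<close>, scaled by
  \<open>w\<close> in the first claim.\<close>

lemma weighted_mediant_between:
  fixes a b c d w :: "'a::linordered_field"
  assumes "0 < b" "0 < d" "0 < w" "a / b < c / d"
  shows "a / b < (a + w * c) / (b + w * d)" "(a + w * c) / (b + w * d) < c / d"
proof -
  have pos: "0 < b + w * d"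
    using assms by (simp add: add_pos_pos)
  have lt: "a * d < c * b"
    using assms by (simp add: divide_simps)
  then have "w * (a * d) < w * (c * b)"
    using assms by simp
  then show "a / b < (a + w * c) / (b + w * d)"
    using assms(1) pos by (simp add: pos_less_divide_eq pos_divide_less_eq algebra_simps)
  show "(a + w * c) / (b + w * d) < c / d"
    using assms(2) pos lt by (simp add: pos_less_divide_eq pos_divide_less_eq algebra_simps)
qed

theorem theorem4p5:
  fixes m :: nat and N :: "nat \<Rightarrow> nat"
    and nv dv snv sdv nv' dv' snv' sdv' :: nat
  assumes "0 < m"
    and "\<And>k. 1 \<le> k \<Longrightarrow> k \<le> m + 1 \<Longrightarrow> 0 < N k"
    and "0 < nv" "0 < dv" "0 < snv" "0 < sdv"
    and "0 < nv'" "0 < dv'" "0 < snv'" "0 < sdv'"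
    and "mat22 nv snv
               dv sdv
         = mat22 0 1
                 1 0 ** ordered_mat_prod (\<lambda>k. mat22 1 1
                                                    (N k) (N k + 1)) m"
    and "mat22 nv' snv'
               dv' sdv'
         = mat22 0 1
                 1 0 ** ordered_mat_prod (\<lambda>k. mat22 1 1
                                                    (N k) (N k + 1)) (m + 1)"
  shows "(of_nat nv / of_nat dv :: rat) < of_nat nv' / of_nat dv' \<and>
         (of_nat nv' / of_nat dv' :: rat) < of_nat snv / of_nat sdv"
proof -
  have "mat22 nv' snv' dv' sdv' = mat22 nv snv dv sdv ** mat22 1 1 (N (m + 1)) (N (m + 1) + 1)"
    using assms(12)
    \<comment> \<open>The rewriting to \<open>Suc\<close> also reaches the entry
      \<open>N k + 1\<close>, so the equation for \<open>m\<close> is put into the same form before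
      it is used to fold the product.\<close>
    by (simp only: Suc_eq_plus1[symmetric] ordered_mat_prod.simps matrix_mul_assoc
        assms(11)[unfolded Suc_eq_plus1[symmetric], symmetric])
  then have child: "nv' = nv + N (m + 1) * snv" "dv' = dv + N (m + 1) * sdv"
    by (simp_all add: mat22_mult mat22_eq_iff mult.commute)
  \<comment> \<open>The determinant identity reads \<open>snv * dv = nv * sdv + 1\<close>
    here.\<close>
  have "nv * sdv < snv * dv"
    using ordered_mat_prod_det[OF assms(11)] by simp
  then have "(of_nat nv * of_nat sdv :: rat) < of_nat snv * of_nat dv"
    by (simp only: of_nat_mult[symmetric] of_nat_less_iff)
  then have "(of_nat nv / of_nat dv :: rat) < of_nat snv / of_nat sdv"
    using assms(4,6) by (simp add: divide_simps)
  moreover have "(0::rat) < of_nat (N (m + 1))"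
    using assms(2) by simp
  ultimately show ?thesis
    using weighted_mediant_between[of "of_nat dv :: rat" "of_nat sdv" "of_nat (N (m + 1))"
        "of_nat nv" "of_nat snv"] assms(4,6)
    by (simp add: child)
qed

end
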